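(* Let $q\ge1$ be an integer, let $a$ be an integer prime to $q$, let $P\ge2$ be an integer, and let $s$ be a complex number with $\Re s>1$. Let $\widehat{G}_q$ be the group of Dirichlet characters modulo $q$. Then $$-\sum_{\substack{p\equiv a\,[q]\\ p\ge P}}\log\left(1-\frac1{p^s}\right)=\sum_{\ell\ge1}\frac{1}{\ell\,\varphi(q)}\sum_{d\mid\ell}\mu(d)\sum_{\chi\in\widehat{G}_q}\overline{\chi}(a)\,\log L_P(\ell s,\chi^d).$$
   Context: The letter $p$ denotes primes; $p\equiv a\,[q]$ means $p\equiv a \pmod q$; $\varphi$ is Euler's function and $\mu$ the Möbius function. For a Dirichlet character $\chi$ modulo $q$ and $\Re s>1$, $$L_P(s,\chi)=\prod_{p\ge P}\left(1-\frac{\chi(p)}{p^s}\right)^{-1},$$ and its logarithm is $\log L_P(s,\chi)=\sum_{p\ge P}\sum_{k\ge1}\frac{\chi(p)^k}{k\,p^{ks}}$ (the branch tending to $0$ as $\Re s\to+\infty$). The character $\chi^d$ is the $d$-th power of $\chi$ in $\widehat{G}_q$ (a character modulo $q$). On the left-hand side $\log$ is the principal branch. *)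

theory Defs
  imports
    "HOL-Algebra.Group"
    "HOL-Analysis.Analysis"
    "HOL-Number_Theory.Number_Theory"
    "HOL-Computational_Algebra.Squarefree"
begin

definition moebius_mu :: "nat \<Rightarrow> int" where
  "moebius_mu n = (if squarefree n then (-1) ^ card (prime_factors n) else 0)"

text \<open>
  Dirichlet characters modulo \<open>q\<close> are regarded as functions on all integers that vanish exactly
  at the integers not prime to \<open>q\<close>.
\<close>

definition dirichlet_character :: "nat \<Rightarrow> (int \<Rightarrow> complex) \<Rightarrow> bool" where
  "dirichlet_character q \<psi> \<longleftrightarrow>
     (\<forall>n. \<psi> n = 0 \<longleftrightarrow> \<not> coprime n (int q)) \<and>
     (\<forall>m n. [m = n] (mod int q) \<longrightarrow> \<psi> m = \<psi> n) \<and>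
     (\<forall>m n. \<psi> (m * n) = \<psi> m * \<psi> n)"

definition dirichlet_group :: "nat \<Rightarrow> (int \<Rightarrow> complex) monoid" where
  "dirichlet_group q =
     \<lparr>carrier = {\<psi>. dirichlet_character q \<psi>},
      monoid.mult = (\<lambda>\<psi> \<xi> n. \<psi> n * \<xi> n),
      one = (\<lambda>n. if coprime n (int q) then 1 else 0)\<rparr>"

definition L_from :: "nat \<Rightarrow> complex \<Rightarrow> (int \<Rightarrow> complex) \<Rightarrow> complex" where
  "L_from P s \<psi> =
     (\<Prod>p. if prime p \<and> p \<ge> P then inverse (1 - \<psi> (int p) / of_nat p powr s) else 1)"

text \<open>
  The branch of the logarithm of \<open>L_from P s \<psi>\<close> that tends to 0 as \<open>Re s\<close> tends to infinity;
  in general it is not \<open>Ln (L_from P s \<psi>)\<close>.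
\<close>

definition log_L_from :: "nat \<Rightarrow> complex \<Rightarrow> (int \<Rightarrow> complex) \<Rightarrow> complex" where
  "log_L_from P s \<psi> =
     (\<Sum>\<^sub>\<infinity>p\<in>{p. prime p \<and> p \<ge> P}. \<Sum>\<^sub>\<infinity>k\<in>{1..}.
        \<psi> (int p) ^ k / (of_nat k * of_nat p powr (of_nat k * s)))"

lemma dirichlet_character_0_iff:
  "dirichlet_character q \<psi> \<Longrightarrow> \<psi> n = 0 \<longleftrightarrow> \<not> coprime n (int q)"
  by (simp add: dirichlet_character_def)

lemma dirichlet_character_cong:
  "dirichlet_character q \<psi> \<Longrightarrow> [m = n] (mod int q) \<Longrightarrow> \<psi> m = \<psi> n"
  by (simp add: dirichlet_character_def)

lemma dirichlet_character_mult:
  "dirichlet_character q \<psi> \<Longrightarrow> \<psi> (m * n) = \<psi> m * \<psi> n"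
  by (simp add: dirichlet_character_def)

lemma dirichlet_character_1:
  assumes "dirichlet_character q \<psi>"
  shows "\<psi> 1 = 1"
  using dirichlet_character_mult[OF assms, of 1 1] dirichlet_character_0_iff[OF assms, of 1]
  by simp

lemma dirichlet_character_power:
  assumes "dirichlet_character q \<psi>"
  shows "\<psi> (m ^ n) = \<psi> m ^ n"
  by (induction n) (simp_all add: dirichlet_character_1[OF assms] dirichlet_character_mult[OF assms])

lemma dirichlet_character_root_of_unity:
  assumes "dirichlet_character q \<psi>" "q \<ge> 1" "coprime n (int q)"
  shows "\<psi> n ^ totient q = 1"
proof -
  define m where "m = nat (n mod int q)"
  have m: "int m = n mod int q"
    using assms(2) by (simp add: m_def)
  have "coprime (int m) (int q)"
    using assms(3) unfolding m by (metis coprime_commute coprime_mod_right_iff assms(2) not_one_le_zero of_nat_eq_0_iff)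
  hence "coprime m q"
    by simp
  hence "[m ^ totient q = 1] (mod q)"
    by (rule euler_theorem)
  hence "[int m ^ totient q = 1] (mod int q)"
    by (metis cong_int_iff of_nat_1 of_nat_power)
  hence "\<psi> (int m ^ totient q) = 1"
    using dirichlet_character_cong[OF assms(1)] dirichlet_character_1[OF assms(1)] by metis
  moreover have "\<psi> (int m) = \<psi> n"
    by (rule dirichlet_character_cong[OF assms(1)]) (simp add: m)
  ultimately show ?thesis
    by (simp add: dirichlet_character_power[OF assms(1)])
qed

lemma norm_dirichlet_character:
  assumes "dirichlet_character q \<psi>" "q \<ge> 1"
  shows "norm (\<psi> n) = (if coprime n (int q) then 1 else 0)"
proof (cases "coprime n (int q)")
  case True
  have "norm (\<psi> n) ^ totient q = 1"
    using dirichlet_character_root_of_unity[OF assms True] by (metis norm_one norm_power)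
  moreover have "totient q > 0"
    using assms(2) by simp
  ultimately have "norm (\<psi> n) = 1"
    by (metis norm_ge_zero power_eq_1_iff not_gr0 real_root_pos_unique power_one zero_le_one)
  thus ?thesis
    using True by simp
qed (use dirichlet_character_0_iff[OF assms(1)] in auto)

lemma comm_group_dirichlet_group:
  assumes "q \<ge> 1"
  shows "comm_group (dirichlet_group q)"
proof (rule comm_groupI)
  fix \<psi> assume "\<psi> \<in> carrier (dirichlet_group q)"
  hence \<psi>: "dirichlet_character q \<psi>"
    by (simp add: dirichlet_group_def)
  define \<xi> where "\<xi> = (\<lambda>n. cnj (\<psi> n))"
  have "dirichlet_character q \<xi>"
    using \<psi> unfolding dirichlet_character_def \<xi>_def by auto
  moreover have "\<xi> n * \<psi> n = (if coprime n (int q) then 1 else 0)" for n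
    using norm_dirichlet_character[OF \<psi> assms, of n] complex_norm_square[of "\<psi> n"]
    by (auto simp: \<xi>_def mult.commute)
  ultimately show "\<exists>\<xi>\<in>carrier (dirichlet_group q). \<xi> \<otimes>\<^bsub>dirichlet_group q\<^esub> \<psi> = \<one>\<^bsub>dirichlet_group q\<^esub>"
    by (intro bexI[of _ \<xi>]) (auto simp: dirichlet_group_def)
next
  have "coprime m (int q) \<longleftrightarrow> coprime n (int q)" if "[m = n] (mod int q)" for m n
    using that by (metis cong_imp_coprime cong_sym)
  thus "\<one>\<^bsub>dirichlet_group q\<^esub> \<in> carrier (dirichlet_group q)"
    by (auto simp: dirichlet_group_def dirichlet_character_def)
next
  fix \<psi> \<xi> assume "\<psi> \<in> carrier (dirichlet_group q)" "\<xi> \<in> carrier (dirichlet_group q)"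
  thus "\<psi> \<otimes>\<^bsub>dirichlet_group q\<^esub> \<xi> \<in> carrier (dirichlet_group q)"
    unfolding dirichlet_group_def dirichlet_character_def
    by (simp add: mult_ac)
next
  fix \<psi> assume "\<psi> \<in> carrier (dirichlet_group q)"
  thus "\<one>\<^bsub>dirichlet_group q\<^esub> \<otimes>\<^bsub>dirichlet_group q\<^esub> \<psi> = \<psi>"
    by (auto simp: dirichlet_group_def dirichlet_character_def)
qed (auto simp: dirichlet_group_def mult_ac)

lemma finite_dirichlet_group:
  assumes "q \<ge> 1"
  shows "finite (carrier (dirichlet_group q))"
proof -
  let ?R = "insert 0 {z :: complex. z ^ totient q = 1}"
  let ?S = "{0..<int q}"
  have "finite ?R"
    using assms by (simp add: finite_roots_unity Suc_leI)
  hence "finite (PiE ?S (\<lambda>_. ?R))"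
    by (intro finite_PiE) auto
  moreover have "(\<lambda>\<psi>. restrict \<psi> ?S) ` carrier (dirichlet_group q) \<subseteq> PiE ?S (\<lambda>_. ?R)"
  proof clarify
    fix \<psi> assume "\<psi> \<in> carrier (dirichlet_group q)"
    hence \<psi>: "dirichlet_character q \<psi>"
      by (simp add: dirichlet_group_def)
    have "\<psi> n \<in> ?R" for n
      using dirichlet_character_0_iff[OF \<psi>, of n] dirichlet_character_root_of_unity[OF \<psi> assms, of n]
      by auto
    thus "restrict \<psi> ?S \<in> PiE ?S (\<lambda>_. ?R)"
      by auto
  qed
  moreover have "inj_on (\<lambda>\<psi>. restrict \<psi> ?S) (carrier (dirichlet_group q))"
  proof (rule inj_onI, rule ext)
    fix \<psi> \<xi> n
    assume "\<psi> \<in> carrier (dirichlet_group q)" "\<xi> \<in> carrier (dirichlet_group q)"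
      and eq: "restrict \<psi> ?S = restrict \<xi> ?S"
    hence *: "dirichlet_character q \<psi>" "dirichlet_character q \<xi>"
      by (simp_all add: dirichlet_group_def)
    have "n mod int q \<in> ?S"
      using assms by simp
    hence "\<psi> (n mod int q) = \<xi> (n mod int q)"
      using eq by (metis restrict_apply')
    moreover have "[n mod int q = n] (mod int q)"
      by simp
    ultimately show "\<psi> n = \<xi> n"
      using dirichlet_character_cong[OF *(1)] dirichlet_character_cong[OF *(2)] by metis
  qed
  ultimately show ?thesis
    using finite_imageD finite_subset by blast
qed

lemma dirichlet_group_pow:
  "(\<psi> [^]\<^bsub>dirichlet_group q\<^esub> (d :: nat)) n = (if coprime n (int q) then 1 else 0) * \<psi> n ^ d"
  by (induction d) (simp_all add: dirichlet_group_def mult_ac)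

text \<open>Consistency of \<open>log_L_from\<close> with the Euler product.\<close>

lemma has_sum_log_euler_factor:
  fixes z :: complex
  assumes "norm z < 1"
  shows "((\<lambda>k. z ^ k / of_nat k) has_sum (- Ln (1 - z))) {1..}"
proof -
  have "summable (\<lambda>k. norm (z ^ k / of_nat k))"
  proof (rule summable_comparison_test'[of "\<lambda>k. norm z ^ k" 0])
    show "norm (norm (z ^ k / of_nat k)) \<le> norm z ^ k" for k
      by (cases "k = 0") (auto simp: norm_divide norm_power divide_le_eq mult_le_cancel_left1)
  qed (use assms in \<open>simp add: summable_geometric\<close>)
  moreover have "(\<lambda>k. (-1) ^ Suc k / of_nat k * (- z) ^ k) sums ln (1 + (- z))"
    by (rule Ln_series) (use assms in simp)
  hence "(\<lambda>k. - ((-1) ^ Suc k / of_nat k * (- z) ^ k)) sums (- ln (1 + (- z)))"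
    by (rule sums_minus)
  moreover have "(\<lambda>k. - ((-1) ^ Suc k / of_nat k * (- z) ^ k)) = (\<lambda>k. z ^ k / of_nat k)"
  proof
    fix k :: nat
    have "(-1) ^ k * (- z) ^ k = ((-1) * (- z)) ^ k"
      by (rule power_mult_distrib[symmetric])
    thus "- ((-1) ^ Suc k / of_nat k * (- z) ^ k) = z ^ k / of_nat k"
      by simp
  qed
  ultimately have "((\<lambda>k. z ^ k / of_nat k) has_sum (- Ln (1 - z))) UNIV"
    using norm_summable_imp_has_sum by fastforce
  thus ?thesis
    by (rule has_sum_cong_neutral[THEN iffD1, rotated -1]) auto
qed

lemma norm_prime_powr_bound:
  fixes z s :: complex
  assumes "norm z \<le> 1" "Re s > 1" "p \<ge> 2"
  shows "norm (z / of_nat p powr s) \<le> 1 / real p powr Re s"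
    and "1 / real p powr Re s < 1 / 2"
proof -
  have "norm (of_nat p powr s :: complex) = real p powr Re s"
    using assms(3) by (subst norm_powr_real_powr) auto
  thus "norm (z / of_nat p powr s) \<le> 1 / real p powr Re s"
    using assms(1) by (simp add: norm_divide divide_right_mono)
  have "2 \<le> real p powr 1"
    using assms(3) by simp
  also have "\<dots> < real p powr Re s"
    using assms(2,3) by (intro powr_less_mono) auto
  finally show "1 / real p powr Re s < 1 / 2"
    by (simp add: divide_less_eq)
qed

theorem exp_log_L_from:
  assumes \<psi>: "dirichlet_character q \<psi>" "q \<ge> 1" and s: "Re s > 1"
  shows "exp (log_L_from P s \<psi>) = L_from P s \<psi>"
proof -
  define A where "A = {p. prime p \<and> p \<ge> P}"
  define z where "z = (\<lambda>p. \<psi> (int p) / of_nat p powr s)"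
  define f where "f = (\<lambda>p. if p \<in> A then - Ln (1 - z p) else 0)"
  have norm_psi: "norm (\<psi> n) \<le> 1" for n
    using norm_dirichlet_character[OF \<psi>, of n] by simp
  have A2: "p \<ge> 2" if "p \<in> A" for p
    using that prime_ge_2_nat by (auto simp: A_def)
  have z_bound: "norm (z p) \<le> 1 / real p powr Re s" "norm (z p) < 1 / 2" if "p \<in> A" for p
  proof -
    note bound = norm_prime_powr_bound[OF norm_psi s A2[OF that]]
    show "norm (z p) \<le> 1 / real p powr Re s"
      unfolding z_def by (rule bound(1))
    also note bound(2)
    finally show "norm (z p) < 1 / 2" .
  qed
  have inner: "(\<Sum>\<^sub>\<infinity>k\<in>{1..}. \<psi> (int p) ^ k / (of_nat k * of_nat p powr (of_nat k * s))) = f p"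
    if "p \<in> A" for p
  proof -
    have "of_nat p powr (of_nat k * s) = (of_nat p powr s :: complex) ^ k" for k
      using A2[OF that] by (simp add: powr_def exp_of_nat_mult[symmetric] mult_ac)
    hence "\<psi> (int p) ^ k / (of_nat k * of_nat p powr (of_nat k * s)) = z p ^ k / of_nat k" for k
      by (simp add: z_def power_divide)
    thus ?thesis
      using has_sum_log_euler_factor[of "z p"] z_bound(2)[OF that] that
      by (simp add: f_def infsumI)
  qed
  have "summable (\<lambda>p. norm (f p))"
  proof (rule summable_comparison_test'[of "\<lambda>p. 2 * (1 / real p powr Re s)" 0])
    show "summable (\<lambda>p. 2 * (1 / real p powr Re s))"
      using s by (intro summable_mult) (simp add: summable_real_powr_iff powr_minus_divide[symmetric])
    show "norm (norm (f p)) \<le> 2 * (1 / real p powr Re s)" for p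
    proof (cases "p \<in> A")
      case True
      have "norm (Ln (1 + (- z p))) \<le> 2 * norm (- z p)"
        by (rule norm_Ln_le) (use z_bound(2)[OF True] in simp)
      thus ?thesis
        using z_bound(1)[OF True] True by (simp add: f_def)
    qed (simp add: f_def)
  qed
  hence sums: "f sums suminf f" and "(f has_sum suminf f) UNIV"
    using summable_norm_cancel norm_summable_imp_has_sum by blast+
  hence "(f has_sum suminf f) A"
    by (subst has_sum_cong_neutral[where T = UNIV and g = f]) (auto simp: f_def)
  hence "log_L_from P s \<psi> = suminf f"
    unfolding log_L_from_def A_def[symmetric] using inner by (simp add: infsumI cong: infsum_cong)
  moreover have "(\<lambda>p. exp (f p)) has_prod exp (suminf f)"
    using sums_imp_has_prod_exp[OF sums] unfolding has_prod_def by blast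
  moreover have "exp (f p) = (if prime p \<and> p \<ge> P then inverse (1 - \<psi> (int p) / of_nat p powr s) else 1)"
    for p
  proof (cases "p \<in> A")
    case True
    hence "1 - z p \<noteq> 0"
      using z_bound(2)[OF True] by auto
    thus ?thesis
      using True by (simp add: f_def exp_minus A_def z_def)
  qed (auto simp: f_def A_def)
  ultimately show ?thesis
    using has_prod_unique[of "\<lambda>p. exp (f p)"] by (simp add: L_from_def)
qed

end

theory Submission
  imports Defs
begin

text \<open>
  Write \<open>w = 1 / p\<^sup>s\<close>. Once the logarithms on the right are expanded, the identity reduces to two
  cancellations. Orthogonality of the characters turns the sum of \<open>cnj (\<psi> a) * \<psi> (p ^ (d * k))\<close>
  over all \<open>\<psi>\<close> into \<open>\<phi>(q)\<close> times the indicator \<open>c (d * k)\<close> of \<open>p ^ (d * k) \<equiv> a\<close> modulo \<open>q\<close>,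
  so that a prime \<open>p\<close> contributes the sum over \<open>l, k \<ge> 1\<close> of
  \<open>w ^ (k * l) / (l * k) * (\<Sum>d | d dvd l. \<mu> d * c (d * k))\<close>. Collecting the terms with
  \<open>k * l = n\<close> gives \<open>w ^ n / n\<close> with the coefficient \<open>\<Sum>m | m dvd n. c m * (\<Sum>d | d dvd m. \<mu> d)\<close>,
  where \<open>m = d * k\<close>; the inner sum of the Moebius function leaves only \<open>c 1\<close>, the indicator of
  \<open>p \<equiv> a\<close>. What remains is the logarithmic series of \<open>1 - w\<close>, for the primes congruent to \<open>a\<close> alone
  (\<open>has_sum_moebius_log\<close>).

  The prime \<open>p\<close> is the outermost index in this computation, but \<open>l\<close> is outermost in the theorem. The
  exchange is legitimate because the triple series over \<open>p, l, k\<close> converges absolutely: as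
  \<open>l\<close> has at most \<open>l\<close> divisors, its terms are bounded by \<open>\<bar>w\<bar> ^ (k * l)\<close>, and \<open>\<bar>w\<bar> \<le> 1 / 2\<close> together with
  \<open>k * l \<ge> k + l - 1\<close> bounds this by \<open>\<bar>w\<bar>\<close> times a product of two geometric terms
  (\<open>summable_on_prime_power_double_series\<close>).

  Orthogonality (\<open>dirichlet_character_orthogonality\<close>) rests on the fact that for every class
  of integers prime to \<open>q\<close>, other than that of 1, some character has a value other than 1 there. Such a
  character is built on a cyclic subgroup first and then extended to the whole unit group one
  generator at a time, which is possible because complex numbers have roots of every order
  (\<open>extend_character_to_carrier\<close>).
\<close>

section \<open>Divisor sums of the Moebius function\<close>

lemma squarefree_eq_prod_prime_factors:
  fixes d :: nat
  assumes "squarefree d"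
  shows "\<Prod>(prime_factors d) = d"
proof -
  have "d \<noteq> 0" using assms by (auto intro: Nat.gr0I)
  have "d = (\<Prod>p\<in>prime_factors d. p ^ multiplicity p d)"
    using \<open>d \<noteq> 0\<close> by (simp add: prod_prime_factors)
  also have "\<dots> = \<Prod>(prime_factors d)"
  proof (rule prod.cong)
    fix p assume p: "p \<in> prime_factors d"
    then have "multiplicity p d = 1"
      using assms \<open>d \<noteq> 0\<close> squarefree_factorial_semiring'[of d] by blast
    then show "p ^ multiplicity p d = p" by simp
  qed simp
  finally show ?thesis by simp
qed

lemma
  fixes A :: "nat set"
  assumes "finite A" and prime: "\<And>p. p \<in> A \<Longrightarrow> prime p"
  shows prime_factors_prod_primes: "prime_factors (\<Prod>A) = A"
    and squarefree_prod_primes: "squarefree (\<Prod>A)"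
proof -
  show "prime_factors (\<Prod>A) = A"
    using assms
  proof (induction A rule: finite_induct)
    case (insert p A)
    then have "p \<noteq> 0" "\<Prod>A \<noteq> 0" by (metis insertI1 not_prime_0, metis insertCI not_prime_0 prod_zero_iff)
    then show ?case using insert by (simp add: prime_factors_product prime_prime_factors)
  qed simp
  show "squarefree (\<Prod>A)"
    by (intro squarefree_prod_coprime) (auto simp: primes_coprime prime squarefree_prime)
qed

text \<open>
  Only squarefree divisors of \<open>m\<close> count, and they correspond to the sets of prime factors of \<open>m\<close>, so the
  sum is the expansion of \<open>\<Prod>p. (1 - 1)\<close>, which vanishes unless the product is empty.
\<close>

lemma sum_moebius_mu_divisors:
  assumes "m > 0"
  shows "(\<Sum>d | d dvd m. moebius_mu d) = (if m = 1 then 1 else 0)"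
proof -
  have "(\<Sum>d | d dvd m. moebius_mu d) = (\<Sum>d | d dvd m \<and> squarefree d. (-1) ^ card (prime_factors d))"
    by (intro sum.mono_neutral_cong_right) (use assms in \<open>auto simp: moebius_mu_def\<close>)
  also have "\<dots> = (\<Sum>A\<in>Pow (prime_factors m). (-1) ^ card A)"
  proof (rule sum.reindex_bij_witness[of _ "\<lambda>A. \<Prod>A" prime_factors])
    fix A assume "A \<in> Pow (prime_factors m)"
    then have A: "A \<subseteq> prime_factors m" "finite A" "\<And>p. p \<in> A \<Longrightarrow> prime p"
      by (auto intro: finite_subset)
    show "prime_factors (\<Prod>A) = A"
      using A by (intro prime_factors_prod_primes) auto
    have "\<Prod>A dvd \<Prod>(prime_factors m)"
      using A by (intro prod_dvd_prod_subset) auto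
    also have "\<dots> dvd (\<Prod>p\<in>prime_factors m. p ^ multiplicity p m)"
      by (intro prod_dvd_prod) (auto simp: prime_factors_multiplicity intro: dvd_power)
    also have "\<dots> = m"
      using assms by (simp add: prod_prime_factors)
    finally show "\<Prod>A \<in> {d. d dvd m \<and> squarefree d}"
      using A by (auto intro: squarefree_prod_primes)
  next
    fix d assume "d \<in> {d. d dvd m \<and> squarefree d}"
    then show "prime_factors d \<in> Pow (prime_factors m)"
      using assms by (auto simp: dvd_prime_factors)
  qed (auto simp: squarefree_eq_prod_prime_factors)
  also have "\<dots> = (\<Prod>p\<in>prime_factors m. 1 - 1 :: int)"
    by (subst prod_diff_conv_sum) simp_all
  also have "\<dots> = (if m = 1 then 1 else 0)"
    using assms by (cases "m = 1") (auto simp: prime_factorization_empty_iff card_gt_0_iff)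
  finally show ?thesis .
qed

lemma abs_moebius_mu_le: "\<bar>moebius_mu d\<bar> \<le> 1"
  by (simp add: moebius_mu_def)

text \<open>
  The substitution \<open>m = d * (n div l)\<close> maps the chains \<open>d dvd l dvd n\<close> bijectively to the chains
  \<open>d dvd m dvd n\<close> and is an involution for fixed \<open>d\<close>. Afterwards \<open>c m\<close> is weighted by the full divisor sum
  of the Moebius function at \<open>m\<close>, so only \<open>m = 1\<close> survives.
\<close>

lemma moebius_mu_double_divisor_sum:
  fixes c :: "nat \<Rightarrow> complex"
  assumes n: "n > 0"
  shows "(\<Sum>l | l dvd n. \<Sum>d | d dvd l. of_int (moebius_mu d) * c (d * (n div l))) = c 1"
proof -
  have pos: "m > 0" if "m dvd n" for m
    using n that by (rule dvd_pos_nat)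
  have fin: "finite {d. d dvd m}" if "m dvd n" for m
    using pos[OF that] by (rule finite_divisors_nat)
  have "(\<Sum>l | l dvd n. \<Sum>d | d dvd l. of_int (moebius_mu d) * c (d * (n div l)))
      = (\<Sum>(l, d)\<in>(SIGMA l:{l. l dvd n}. {d. d dvd l}). of_int (moebius_mu d) * c (d * (n div l)))"
    by (intro sum.Sigma) (simp_all add: fin)
  also have "\<dots> = (\<Sum>(m, d)\<in>(SIGMA m:{m. m dvd n}. {d. d dvd m}). of_int (moebius_mu d) * c m)"
  proof (rule sum.reindex_bij_witness[where i = "\<lambda>(m, d). (d * (n div m), d)" and j = "\<lambda>(l, d). (d * (n div l), d)"])
    have *: "d * (n div (d * (n div l))) = l" "d * (n div l) dvd n" "d dvd d * (n div l)"
      if dvd: "l dvd n" "d dvd l" for l d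
    proof -
      obtain e k where "l = d * e" "n = d * e * k" using dvd by (auto elim!: dvdE)
      then show "d * (n div (d * (n div l))) = l" "d * (n div l) dvd n" "d dvd d * (n div l)"
        using n by auto
    qed
    fix x assume "x \<in> (SIGMA l:{l. l dvd n}. {d. d dvd l})"
    then obtain l d where x: "x = (l, d)" "l dvd n" "d dvd l" by auto
    note ld = *[OF x(2,3)]
    show "(case (case x of (l, d) \<Rightarrow> (d * (n div l), d)) of (m, d) \<Rightarrow> (d * (n div m), d)) = x"
      "(case x of (l, d) \<Rightarrow> (d * (n div l), d)) \<in> (SIGMA m:{m. m dvd n}. {d. d dvd m})"
      "(case x of (l, d) \<Rightarrow> (d * (n div l), d)) \<in> (SIGMA m:{m. m dvd n}. {d. d dvd m})"
      "(case (case x of (l, d) \<Rightarrow> (d * (n div l), d)) of (m, d) \<Rightarrow> (d * (n div m), d)) = x"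
      using ld by (simp_all add: x(1))
  qed auto
  also have "\<dots> = (\<Sum>m | m dvd n. \<Sum>d | d dvd m. of_int (moebius_mu d) * c m)"
    by (intro sum.Sigma[symmetric]) (simp_all add: fin)
  also have "\<dots> = (\<Sum>m | m dvd n. if m = 1 then c 1 else 0)"
  proof (rule sum.cong)
    fix m assume "m \<in> {m. m dvd n}"
    then have "m > 0" by (simp add: pos)
    have "(\<Sum>d | d dvd m. of_int (moebius_mu d) * c m) = of_int (\<Sum>d | d dvd m. moebius_mu d) * c m"
      by (simp add: sum_distrib_right)
    also have "\<dots> = (if m = 1 then c 1 else 0)"
      using sum_moebius_mu_divisors[OF \<open>m > 0\<close>] by simp
    finally show "(\<Sum>d | d dvd m. of_int (moebius_mu d) * c m) = (if m = 1 then c 1 else 0)" .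
  qed simp
  also have "\<dots> = c 1"
    using n by simp
  finally show ?thesis .
qed

section \<open>Extension of characters of finite abelian groups\<close>

text \<open>
  A partial character is only prescribed on a subgroup; its values elsewhere are arbitrary. This
  allows extending a character from a subgroup to a larger one without changing its type. Values on the
  subgroup are automatically nonzero, since \<open>\<phi> x\<close> and \<open>\<phi> (inv x)\<close> multiply to 1.
\<close>

definition partial_character :: "('a, 'b) monoid_scheme \<Rightarrow> 'a set \<Rightarrow> ('a \<Rightarrow> complex) \<Rightarrow> bool" where
  "partial_character G H \<phi> \<longleftrightarrow> subgroup H G \<and> \<phi> \<one>\<^bsub>G\<^esub> = 1 \<and>
     (\<forall>x\<in>H. \<forall>y\<in>H. \<phi> (x \<otimes>\<^bsub>G\<^esub> y) = \<phi> x * \<phi> y)"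

context comm_group
begin

lemma partial_character_nonzero:
  assumes "partial_character G H \<phi>" "h \<in> H"
  shows "\<phi> h \<noteq> 0"
proof -
  have H: "subgroup H G" using assms(1) by (simp add: partial_character_def)
  have "inv h \<in> H" "h \<in> carrier G"
    using H assms(2) by (auto simp: subgroup.m_inv_closed subgroup.mem_carrier)
  then have "\<phi> h * \<phi> (inv h) = \<phi> \<one>"
    using assms by (metis partial_character_def r_inv)
  then show ?thesis using assms(1) by (auto simp: partial_character_def)
qed

lemma partial_character_int_pow:
  assumes \<phi>: "partial_character G H \<phi>" and h: "h \<in> H"
  shows "\<phi> (h [^] (k :: int)) = \<phi> h powi k"
proof -
  have H: "subgroup H G" using \<phi> by (simp add: partial_character_def)
  have nat: "\<phi> (y [^] n) = \<phi> y ^ n" if "y \<in> H" for y and n :: nat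
  proof (induction n)
    case (Suc n)
    have "y [^] n \<in> H"
      using subgroup_int_pow_closed[OF H that, of "int n"] by (simp add: int_pow_int)
    then show ?case using Suc \<phi> that by (simp add: partial_character_def)
  qed (use \<phi> in \<open>simp add: partial_character_def\<close>)
  have hc: "h \<in> carrier G" "inv h \<in> H"
    using H h by (auto simp: subgroup.m_inv_closed subgroup.mem_carrier)
  have "\<phi> h * \<phi> (inv h) = \<phi> \<one>"
    using \<phi> h hc by (metis partial_character_def r_inv)
  then have inv: "\<phi> (inv h) = inverse (\<phi> h)"
    using \<phi> by (metis inverse_unique partial_character_def)
  show ?thesis
  proof (cases k rule: int_cases2)
    case (nonneg n)
    then show ?thesis using nat[OF h, of n] by (simp add: int_pow_int)
  next
    case (nonpos n)
    have "h [^] k = inv h [^] n"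
      unfolding nonpos int_pow_neg_int[OF hc(1)] using hc(1) by (rule nat_pow_inv[symmetric])
    then have "\<phi> (h [^] k) = inverse (\<phi> h) ^ n"
      using nat[OF hc(2), of n] inv by simp
    then show ?thesis
      by (simp add: nonpos power_int_minus power_inverse)
  qed
qed

text \<open>
  The subgroup generated by \<open>H\<close> and \<open>x\<close> consists of the products \<open>h \<otimes> x [^] k\<close>, and \<open>\<phi> h * c powi k\<close>
  is the only candidate for the value there. The compatibility condition on \<open>c\<close> is exactly what makes it
  independent of the representation: two representations differ by a power of \<open>x\<close> lying in \<open>H\<close>.
\<close>

lemma extend_partial_character:
  assumes \<phi>: "partial_character G H \<phi>" and x: "x \<in> carrier G" and c: "c \<noteq> 0"
    and compat: "\<And>k :: int. x [^] k \<in> H \<Longrightarrow> \<phi> (x [^] k) = c powi k"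
  shows "\<exists>K \<xi>. partial_character G K \<xi> \<and> H \<subseteq> K \<and> x \<in> K \<and> (\<forall>h\<in>H. \<xi> h = \<phi> h) \<and> \<xi> x = c"
proof -
  have H: "subgroup H G" using \<phi> by (simp add: partial_character_def)
  have sub: "h \<in> carrier G" if "h \<in> H" for h using H that by (rule subgroup.mem_carrier)
  have mult: "\<phi> (y \<otimes> z) = \<phi> y * \<phi> z" if "y \<in> H" "z \<in> H" for y z
    using \<phi> that by (simp add: partial_character_def)
  define K where "K = {h \<otimes> x [^] (k :: int) | h k. h \<in> H}"
  define \<xi> where "\<xi> y = (THE v. \<exists>h\<in>H. \<exists>k :: int. y = h \<otimes> x [^] k \<and> v = \<phi> h * c powi k)" for y
  have unique: "\<phi> h * c powi i = \<phi> h' * c powi j"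
    if h: "h \<in> H" "h' \<in> H" and eq: "h \<otimes> x [^] i = h' \<otimes> x [^] j" for h h' and i j :: int
  proof -
    have [simp]: "h \<in> carrier G" "h' \<in> carrier G" using h sub by auto
    have "h \<otimes> x [^] (i - j) = h \<otimes> x [^] i \<otimes> inv (x [^] j)"
      using x by (simp add: int_pow_diff m_assoc)
    also have "\<dots> = h'"
      unfolding eq using x by (simp add: m_assoc)
    finally have *: "h \<otimes> x [^] (i - j) = h'" .
    then have "x [^] (i - j) = inv h \<otimes> h'"
      using x by (simp add: inv_solve_left)
    then have in_H: "x [^] (i - j) \<in> H"
      using h H by (simp add: subgroup.m_closed subgroup.m_inv_closed)
    have "\<phi> h' = \<phi> h * c powi (i - j)"
      using mult[OF h(1) in_H] compat[OF in_H] * by simp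
    then show ?thesis using c by (simp add: power_int_diff)
  qed
  have \<xi>: "\<xi> (h \<otimes> x [^] k) = \<phi> h * c powi k" if "h \<in> H" for h and k :: int
    unfolding \<xi>_def using that by (intro the_equality) (auto dest: unique)
  have [simp]: "\<one> \<in> H" "\<phi> \<one> = 1" using H \<phi> by (auto simp: subgroup.one_closed partial_character_def)
  have mult_form: "(h \<otimes> x [^] i) \<otimes> (h' \<otimes> x [^] j) = (h \<otimes> h') \<otimes> x [^] (i + j)"
    if "h \<in> H" "h' \<in> H" for h h' and i j :: int
    using that sub x by (simp add: int_pow_mult m_ac)
  have K: "subgroup K G"
  proof (rule subgroupI)
    show "K \<subseteq> carrier G" using sub x by (auto simp: K_def)
    show "K \<noteq> {}" using \<open>\<one> \<in> H\<close> unfolding K_def by blast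
  next
    fix y assume "y \<in> K"
    then obtain h and k :: int where "h \<in> H" "y = h \<otimes> x [^] k" by (auto simp: K_def)
    then have "inv y = inv h \<otimes> x [^] (- k)" "inv h \<in> H"
      using sub x H by (auto simp: inv_mult int_pow_neg subgroup.m_inv_closed)
    then show "inv y \<in> K" unfolding K_def by blast
  next
    fix y z assume "y \<in> K" "z \<in> K"
    then show "y \<otimes> z \<in> K"
      unfolding K_def using mult_form H by (blast intro: subgroup.m_closed)
  qed
  have "\<xi> (y \<otimes> z) = \<xi> y * \<xi> z" if yz: "y \<in> K" "z \<in> K" for y z
  proof -
    obtain h h' and i j :: int where h: "h \<in> H" "h' \<in> H" and y: "y = h \<otimes> x [^] i" and z: "z = h' \<otimes> x [^] j"
      using yz by (auto simp: K_def)
    have "h \<otimes> h' \<in> H" using h H by (simp add: subgroup.m_closed)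
    then show ?thesis
      unfolding y z using c h by (simp add: mult_form \<xi> mult power_int_add)
  qed
  moreover have \<xi>_H: "\<xi> h = \<phi> h" if "h \<in> H" for h
    using \<xi>[OF that, of 0] sub[OF that] by simp
  ultimately have "partial_character G K \<xi>"
    using K by (simp add: partial_character_def)
  moreover have "H \<subseteq> K"
  proof
    fix h assume "h \<in> H"
    then have "h = h \<otimes> x [^] (0 :: int)" using sub by simp
    then show "h \<in> K" unfolding K_def using \<open>h \<in> H\<close> by blast
  qed
  moreover have "x = \<one> \<otimes> x [^] (1 :: int)" using x by simp
  then have "x \<in> K" "\<xi> x = c"
    using \<xi>[of \<one> 1] \<open>\<one> \<in> H\<close> by (force simp: K_def, simp)
  ultimately show ?thesis
    using \<xi>_H by (intro exI[of _ K] exI[of _ \<xi>]) auto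
qed

text \<open>
  The exponents \<open>k\<close> with \<open>x [^] k \<in> H\<close> are the multiples of the least positive one, \<open>m\<close>. So the
  compatibility condition for all \<open>k\<close> follows from the single equation \<open>c ^ m = \<phi> (x [^] m)\<close>, which has a
  complex solution.
\<close>

lemma compatible_value_exists:
  assumes fin: "finite (carrier G)" and \<phi>: "partial_character G H \<phi>" and x: "x \<in> carrier G"
  obtains c where "c \<noteq> 0" "\<And>k :: int. x [^] k \<in> H \<Longrightarrow> \<phi> (x [^] k) = c powi k"
proof -
  have H: "subgroup H G" using \<phi> by (simp add: partial_character_def)
  define m where "m = (LEAST m :: nat. m > 0 \<and> x [^] m \<in> H)"
  have "ord x > 0 \<and> x [^] ord x \<in> H"
    using fin x H ord_ge_1[of x] by (simp add: subgroup.one_closed)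
  then have m: "m > 0" "x [^] m \<in> H"
    unfolding m_def by (metis (mono_tags, lifting) LeastI)+
  have min: "m \<le> n" if "n > 0" "x [^] n \<in> H" for n :: nat
    unfolding m_def using that by (intro Least_le) auto
  obtain c where c: "c \<noteq> 0" "\<phi> (x [^] m) = c ^ m"
    using exists_complex_root_nonzero[OF partial_character_nonzero[OF \<phi> m(2)], of m] m(1) by blast
  have "\<phi> (x [^] k) = c powi k" if k: "x [^] k \<in> H" for k :: int
  proof -
    define t r where "t = k div int m" and "r = nat (k mod int m)"
    have r: "int r = k - int m * t" "r < m"
      using m(1) by (auto simp: r_def t_def minus_mult_div_eq_mod nat_less_iff)
    have pow: "x [^] (int m * t) = (x [^] m) [^] t"
      using x by (simp add: int_pow_pow flip: int_pow_int)
    have "(x [^] m) [^] t \<in> H"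
      using subgroup_int_pow_closed[OF H m(2)] .
    moreover have "x [^] r = x [^] k \<otimes> inv ((x [^] m) [^] t)"
      using x r(1) pow by (metis int_pow_int int_pow_diff)
    ultimately have "x [^] r \<in> H"
      using k H by (simp add: subgroup.m_closed subgroup.m_inv_closed)
    then have "r = 0" using min[of r] r(2) by fastforce
    then have k_eq: "k = int m * t" using r(1) by simp
    then have "\<phi> (x [^] k) = \<phi> (x [^] m) powi t"
      using partial_character_int_pow[OF \<phi> m(2)] pow by simp
    also have "\<dots> = c powi k"
      by (simp add: c(2) k_eq power_int_mult)
    finally show ?thesis .
  qed
  then show ?thesis using c(1) that by blast
qed

text \<open>
  Adjoining an element outside of the subgroup enlarges it, so finitely many extensions suffice.
\<close>

lemma extend_character_to_carrier:
  assumes fin: "finite (carrier G)" and \<phi>: "partial_character G H \<phi>"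
  shows "\<exists>\<xi>. partial_character G (carrier G) \<xi> \<and> (\<forall>h\<in>H. \<xi> h = \<phi> h)"
  using \<phi>
proof (induction "card (carrier G - H)" arbitrary: H \<phi> rule: less_induct)
  case less
  show ?case
  proof (cases "H = carrier G")
    case True
    then show ?thesis using less.prems by (intro exI[of _ \<phi>]) simp
  next
    case False
    have "H \<subseteq> carrier G"
      using less.prems by (simp add: partial_character_def subgroup.subset)
    then obtain x where x: "x \<in> carrier G" "x \<notin> H" using False by blast
    obtain c where c: "c \<noteq> 0" "\<And>k :: int. x [^] k \<in> H \<Longrightarrow> \<phi> (x [^] k) = c powi k"
      by (rule compatible_value_exists[OF fin less.prems x(1)]) (rule that)
    obtain K \<eta> where K: "partial_character G K \<eta>" "H \<subseteq> K" "x \<in> K" "\<forall>h\<in>H. \<eta> h = \<phi> h"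
      using extend_partial_character[OF less.prems x(1) c] by blast
    have "card (carrier G - K) < card (carrier G - H)"
      using K x fin by (intro psubset_card_mono) auto
    from less.hyps[OF this K(1)] obtain \<xi> where
      \<xi>: "partial_character G (carrier G) \<xi>" "\<forall>h\<in>K. \<xi> h = \<eta> h" by blast
    show ?thesis
      by (rule exI[of _ \<xi>]) (use \<xi> K(2,4) in auto)
  qed
qed

text \<open>
  The construction starts from the trivial character of the trivial subgroup: sending \<open>x\<close> to any
  \<open>c\<close> with \<open>c ^ ord x = 1\<close> is compatible with it. As \<open>ord x \<ge> 2\<close>, there is a choice with \<open>c \<noteq> 1\<close>.
\<close>

lemma character_separating_one:
  assumes fin: "finite (carrier G)" and x: "x \<in> carrier G" "x \<noteq> \<one>"
  obtains \<phi> where "partial_character G (carrier G) \<phi>" "\<phi> x \<noteq> 1"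
proof -
  define n where "n = ord x"
  have "n > 0" unfolding n_def using fin x(1) ord_ge_1[of x] by simp
  moreover have "n \<noteq> 1" unfolding n_def using x pow_eq_id[of x 1] by auto
  ultimately have "n \<ge> 2" by simp
  have "card {z :: complex. z ^ n = 1} = n"
    using \<open>n > 0\<close> by (rule card_roots_unity_eq)
  then have "\<not> {z :: complex. z ^ n = 1} \<subseteq> {1}"
    using \<open>n \<ge> 2\<close> card_mono[of "{1 :: complex}" "{z. z ^ n = 1}"] by auto
  then obtain c :: complex where "c ^ n = 1" "c \<noteq> 1"
    by blast
  have trivial: "partial_character G {\<one>} (\<lambda>_. 1)"
    by (simp add: partial_character_def triv_subgroup)
  have compat: "1 = c powi k" if k: "x [^] k \<in> {\<one>}" for k :: int
  proof -
    obtain t where "k = int n * t"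
      using k x(1) by (auto simp: int_pow_eq_id n_def)
    then show ?thesis using \<open>c ^ n = 1\<close> by (simp add: power_int_mult)
  qed
  have "c \<noteq> 0" using \<open>c ^ n = 1\<close> \<open>n > 0\<close> by (auto simp: power_0_left)
  have "\<exists>K \<eta>. partial_character G K \<eta> \<and> {\<one>} \<subseteq> K \<and> x \<in> K \<and> (\<forall>h\<in>{\<one>}. \<eta> h = 1) \<and> \<eta> x = c"
    by (rule extend_partial_character) (fact trivial, fact x(1), fact \<open>c \<noteq> 0\<close>, rule compat)
  then obtain K \<eta> where \<eta>: "partial_character G K \<eta>" "x \<in> K" "\<eta> x = c"
    by blast
  obtain \<xi> where "partial_character G (carrier G) \<xi>" "\<forall>h\<in>K. \<xi> h = \<eta> h"
    using extend_character_to_carrier[OF fin \<eta>(1)] by blast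
  then show ?thesis
    using \<eta>(2,3) \<open>c \<noteq> 1\<close> by (intro that[of \<xi>]) auto
qed

end

text \<open>
  This is \<open>character_separating_one\<close> for the unit group of the residue ring, with the character
  pulled back to the integers along \<open>k \<mapsto> k mod q\<close> and set to 0 on integers not prime to \<open>q\<close>.
\<close>

lemma dirichlet_character_separating_one:
  assumes q: "q \<ge> 1" and n: "coprime n (int q)" "\<not> [n = 1] (mod int q)"
  obtains \<psi> where "dirichlet_character q \<psi>" "\<psi> n \<noteq> 1"
proof -
  \<comment> \<open>Residue rings are only considered for moduli above 1; for \<open>q = 1\<close> all integers are congruent.\<close>
  have "q > 1" using q n(2) by (cases "q = 1") auto
  define R where "R = residue_ring (int q)"
  interpret residues "int q" R
    by unfold_locales (use \<open>q > 1\<close> in \<open>simp_all add: R_def\<close>)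
  interpret U: comm_group "units_of R" by (rule units_comm_group)
  have in_units: "k mod int q \<in> carrier (units_of R)" if "coprime k (int q)" for k
    using that \<open>q > 1\<close> by (simp add: units_of_carrier)
  have "n mod int q \<noteq> \<one>\<^bsub>units_of R\<^esub>"
    using n(2) \<open>q > 1\<close> by (simp add: units_of_one res_one_eq cong_def)
  then obtain \<phi> where \<phi>: "partial_character (units_of R) (carrier (units_of R)) \<phi>" "\<phi> (n mod int q) \<noteq> 1"
    using U.character_separating_one[OF _ in_units[OF n(1)]] by (auto simp: units_of_carrier)
  define \<psi> where "\<psi> k = (if coprime k (int q) then \<phi> (k mod int q) else 0)" for k
  have "dirichlet_character q \<psi>"
    unfolding dirichlet_character_def
  proof (intro conjI allI impI)
    fix k show "\<psi> k = 0 \<longleftrightarrow> \<not> coprime k (int q)"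
      using U.partial_character_nonzero[OF \<phi>(1) in_units] by (auto simp: \<psi>_def)
  next
    fix k l assume "[k = l] (mod int q)"
    then show "\<psi> k = \<psi> l"
      using cong_imp_coprime cong_sym unfolding \<psi>_def cong_def by metis
  next
    fix k l
    have "\<phi> (k * l mod int q) = \<phi> (k mod int q) * \<phi> (l mod int q)"
      if kl: "coprime k (int q)" "coprime l (int q)"
    proof -
      have "k * l mod int q = (k mod int q) \<otimes>\<^bsub>units_of R\<^esub> (l mod int q)"
        by (simp add: units_of_mult res_mult_eq mod_mult_eq)
      then show ?thesis
        using \<phi>(1) kl by (simp add: partial_character_def in_units)
    qed
    then show "\<psi> (k * l) = \<psi> k * \<psi> l" by (auto simp: \<psi>_def)
  qed
  moreover have "\<psi> n \<noteq> 1" using \<phi>(2) n(1) by (simp add: \<psi>_def)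
  ultimately show ?thesis using that by blast
qed

section \<open>Orthogonality of Dirichlet characters\<close>

lemma bij_betw_mult_mod:
  fixes q :: nat and k :: int
  assumes "q \<ge> 1" "coprime k (int q)"
  shows "bij_betw (\<lambda>n. k * n mod int q) {0..<int q} {0..<int q}"
proof -
  have inj: "inj_on (\<lambda>n. k * n mod int q) {0..<int q}"
  proof (rule inj_onI)
    fix m n assume mn: "m \<in> {0..<int q}" "n \<in> {0..<int q}" "k * m mod int q = k * n mod int q"
    then have "[k * m = k * n] (mod int q)"
      by (simp add: cong_def)
    then have "[m = n] (mod int q)"
      using assms(2) by (simp add: cong_mult_lcancel)
    then show "m = n"
      using mn by (simp add: cong_def)
  qed
  moreover have "(\<lambda>n. k * n mod int q) ` {0..<int q} \<subseteq> {0..<int q}"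
    using assms(1) by auto
  ultimately show ?thesis
    using endo_inj_surj[of "{0..<int q}"] by (auto simp: bij_betw_def)
qed

text \<open>
  For a nonprincipal character choose \<open>k\<close> with \<open>\<psi> k \<noteq> 1\<close>: multiplication by \<open>k\<close> permutes the
  residues, so the sum is unchanged when multiplied by \<open>\<psi> k\<close> and hence vanishes.
\<close>

lemma sum_dirichlet_character_residues:
  assumes q: "q \<ge> 1" and \<psi>: "dirichlet_character q \<psi>"
  shows "(\<Sum>n\<in>{0..<int q}. \<psi> n) = (if \<psi> = \<one>\<^bsub>dirichlet_group q\<^esub> then of_nat (totient q) else 0)"
proof (cases "\<psi> = \<one>\<^bsub>dirichlet_group q\<^esub>")
  case True
  have "(\<Sum>n\<in>{0..<int q}. \<psi> n) = (\<Sum>n\<in>{0..<int q}. if coprime n (int q) then 1 else 0)"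
    using True by (simp add: dirichlet_group_def)
  also have "\<dots> = of_nat (card {n \<in> {0..<int q}. coprime n (int q)})"
    by (simp add: sum.If_cases Int_def)
  also have "card {n \<in> {0..<int q}. coprime n (int q)} = card {k \<in> {0..<q}. coprime k q}"
    by (rule bij_betw_same_card[of nat], rule bij_betwI[of _ _ _ int])
      (auto simp: nat_less_iff simp flip: coprime_int_iff)
  also have "\<dots> = totient q"
  proof (cases "q = 1")
    case False
    have "{k \<in> {0..<q}. coprime k q} = totatives q"
      using q False by (auto simp: totatives_def intro!: Nat.gr0I simp: order.order_iff_strict)
    then show ?thesis by (simp add: totient_def)
  qed (auto simp: Collect_conv_if)
  finally show ?thesis using True by simp
next
  case False
  have "\<exists>k. coprime k (int q) \<and> \<psi> k \<noteq> 1"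
  proof (rule ccontr)
    assume "\<not> ?thesis"
    then have "\<psi> = \<one>\<^bsub>dirichlet_group q\<^esub>"
      using dirichlet_character_0_iff[OF \<psi>] by (intro ext) (auto simp: dirichlet_group_def)
    with False show False ..
  qed
  then obtain k where k: "coprime k (int q)" "\<psi> k \<noteq> 1" by blast
  have "\<psi> k * (\<Sum>n\<in>{0..<int q}. \<psi> n) = (\<Sum>n\<in>{0..<int q}. \<psi> (k * n mod int q))"
    unfolding sum_distrib_left dirichlet_character_mult[OF \<psi>, symmetric]
    by (intro sum.cong refl dirichlet_character_cong[OF \<psi>]) (simp add: cong_def)
  also have "\<dots> = (\<Sum>n\<in>{0..<int q}. \<psi> n)"
    by (rule sum.reindex_bij_betw[OF bij_betw_mult_mod[OF q k(1)]])
  finally show ?thesis using k(2) False by simp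
qed

text \<open>
  The dual argument: multiplication by a character \<open>\<xi>\<close> with \<open>\<xi> n \<noteq> 1\<close> permutes the characters.
  If \<open>n\<close> is not prime to \<open>q\<close>, every term is 0.
\<close>

lemma sum_dirichlet_characters_eq_0:
  assumes q: "q \<ge> 1" and n: "\<not> [n = 1] (mod int q)"
  shows "(\<Sum>\<psi>\<in>carrier (dirichlet_group q). \<psi> n) = 0"
proof (cases "coprime n (int q)")
  case False
  then show ?thesis
    by (intro sum.neutral) (auto simp: dirichlet_group_def dirichlet_character_0_iff)
next
  case True
  obtain \<xi> where \<xi>: "dirichlet_character q \<xi>" "\<xi> n \<noteq> 1"
    using dirichlet_character_separating_one[OF q True n] .
  interpret D: comm_group "dirichlet_group q"
    using q by (rule comm_group_dirichlet_group)
  have \<xi>_in: "\<xi> \<in> carrier (dirichlet_group q)"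
    using \<xi>(1) by (simp add: dirichlet_group_def)
  have "\<xi> n * (\<Sum>\<psi>\<in>carrier (dirichlet_group q). \<psi> n)
      = (\<Sum>\<psi>\<in>carrier (dirichlet_group q). (\<xi> \<otimes>\<^bsub>dirichlet_group q\<^esub> \<psi>) n)"
    by (simp add: sum_distrib_left dirichlet_group_def)
  also have "\<dots> = (\<Sum>\<psi>\<in>carrier (dirichlet_group q). \<psi> n)"
  proof (rule sum.reindex_bij_betw)
    show "bij_betw ((\<otimes>\<^bsub>dirichlet_group q\<^esub>) \<xi>) (carrier (dirichlet_group q)) (carrier (dirichlet_group q))"
      using D.inj_on_multc D.surj_const_mult[OF \<xi>_in] D.inj_on_cmult[OF \<xi>_in]
      by (simp add: bij_betw_def)
  qed
  finally show ?thesis using \<xi>(2) by simp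
qed

text \<open>
  Double counting of the sum of \<open>\<psi> n\<close> over all characters and residues: summing over the
  characters first, only the residue class of 1 contributes and gives their number; summing over the
  residues first, only the principal character contributes and gives \<open>\<phi>(q)\<close>.
\<close>

lemma card_dirichlet_group:
  assumes q: "q \<ge> 1"
  shows "card (carrier (dirichlet_group q)) = totient q"
proof -
  let ?D = "carrier (dirichlet_group q)" and ?r = "1 mod int q"
  interpret D: comm_group "dirichlet_group q"
    using q by (rule comm_group_dirichlet_group)
  have char: "dirichlet_character q \<psi>" if "\<psi> \<in> ?D" for \<psi>
    using that by (simp add: dirichlet_group_def)
  \<comment> \<open>The residue of 1 is written \<open>1 mod q\<close> because it is 0 when \<open>q = 1\<close>.\<close>
  have "(\<Sum>n\<in>{0..<int q}. \<Sum>\<psi>\<in>?D. \<psi> n) = (\<Sum>n\<in>{?r}. \<Sum>\<psi>\<in>?D. \<psi> n)"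
    using q by (intro sum.mono_neutral_right) (auto simp: sum_dirichlet_characters_eq_0 cong_def)
  also have "\<dots> = (\<Sum>\<psi>\<in>?D. \<psi> 1)"
    by (simp, intro sum.cong refl) (rule dirichlet_character_cong[OF char], simp_all)
  also have "\<dots> = of_nat (card ?D)"
    by (simp add: dirichlet_character_1[OF char])
  finally have "of_nat (card ?D) = (\<Sum>\<psi>\<in>?D. \<Sum>n\<in>{0..<int q}. \<psi> n)"
    by (simp add: sum.swap[of _ ?D])
  also have "\<dots> = (\<Sum>\<psi>\<in>?D. if \<psi> = \<one>\<^bsub>dirichlet_group q\<^esub> then of_nat (totient q) else 0)"
    by (intro sum.cong refl sum_dirichlet_character_residues[OF q char])
  also have "\<dots> = (of_nat (totient q) :: complex)"
    using finite_dirichlet_group[OF q] by simp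
  finally show ?thesis by (simp only: of_nat_eq_iff)
qed

text \<open>
  If \<open>b\<close> is an inverse of \<open>a\<close> modulo \<open>q\<close>, then \<open>cnj (\<psi> a) = \<psi> b\<close> because \<open>\<psi> a\<close> has modulus 1. So the sum is
  that of \<open>\<psi> (b * n)\<close>, and \<open>b * n \<equiv> 1\<close> means \<open>n \<equiv> a\<close>.
\<close>

lemma dirichlet_character_orthogonality:
  assumes q: "q \<ge> 1" and a: "coprime a (int q)"
  shows "(\<Sum>\<psi>\<in>carrier (dirichlet_group q). cnj (\<psi> a) * \<psi> n)
       = (if [n = a] (mod int q) then of_nat (totient q) else 0)"
proof -
  let ?D = "carrier (dirichlet_group q)"
  have char: "dirichlet_character q \<psi>" if "\<psi> \<in> ?D" for \<psi>
    using that by (simp add: dirichlet_group_def)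
  obtain b where b: "[a * b = 1] (mod int q)"
    using a cong_solve_coprime_int by blast
  have "cnj (\<psi> a) * \<psi> n = \<psi> (b * n)" if "\<psi> \<in> ?D" for \<psi>
  proof -
    have "\<psi> a * \<psi> b = 1"
      using dirichlet_character_cong[OF char[OF that] b]
      by (simp add: dirichlet_character_mult[OF char[OF that]] dirichlet_character_1[OF char[OF that]])
    moreover have "\<psi> a * cnj (\<psi> a) = 1"
      using norm_dirichlet_character[OF char[OF that] q, of a] a
      by (simp add: complex_norm_square[symmetric])
    ultimately have "cnj (\<psi> a) = \<psi> b"
      by (metis inverse_unique)
    then show ?thesis by (simp add: dirichlet_character_mult[OF char[OF that]])
  qed
  then have "(\<Sum>\<psi>\<in>?D. cnj (\<psi> a) * \<psi> n) = (\<Sum>\<psi>\<in>?D. \<psi> (b * n))"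
    by (intro sum.cong) auto
  also have "\<dots> = (if [b * n = 1] (mod int q) then of_nat (totient q) else 0)"
  proof (cases "[b * n = 1] (mod int q)")
    case True
    have "(\<Sum>\<psi>\<in>?D. \<psi> (b * n)) = (\<Sum>\<psi>\<in>?D. 1)"
      by (intro sum.cong refl)
        (simp add: dirichlet_character_cong[OF char True] dirichlet_character_1[OF char])
    then show ?thesis using True by (simp add: card_dirichlet_group[OF q])
  qed (simp add: sum_dirichlet_characters_eq_0[OF q])
  also have "[b * n = 1] (mod int q) \<longleftrightarrow> [n = a] (mod int q)"
  proof
    assume "[b * n = 1] (mod int q)"
    then have "[a * (b * n) = a * 1] (mod int q)" by (rule cong_scalar_left)
    moreover have "[(a * b) * n = 1 * n] (mod int q)" using b by (rule cong_scalar_right)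
    ultimately show "[n = a] (mod int q)"
      by (metis cong_sym cong_trans mult.assoc mult_1 mult_1_right)
  next
    assume "[n = a] (mod int q)"
    then have "[b * n = b * a] (mod int q)" by (rule cong_scalar_left)
    then show "[b * n = 1] (mod int q)"
      using b by (metis cong_trans mult.commute)
  qed
  finally show ?thesis .
qed

section \<open>The double series attached to a single prime\<close>

text \<open>
  The coefficient of \<open>w ^ (k * l)\<close> in the contribution of a single prime, after the characters have
  been summed; \<open>c m\<close> stands for the indicator of \<open>p ^ m \<equiv> a\<close>.
\<close>

definition moebius_log_coeff :: "(nat \<Rightarrow> complex) \<Rightarrow> nat \<Rightarrow> nat \<Rightarrow> complex" where
  "moebius_log_coeff c l k =
     (\<Sum>d | d dvd l. of_int (moebius_mu d) * c (d * k)) / (of_nat l * of_nat k)"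

lemma norm_moebius_log_coeff_le:
  assumes "l \<ge> 1" "k \<ge> 1" and c: "\<And>n. norm (c n) \<le> 1"
  shows "norm (moebius_log_coeff c l k) \<le> 1"
proof -
  have "norm (\<Sum>d | d dvd l. of_int (moebius_mu d) * c (d * k)) \<le> (\<Sum>d | d dvd l. 1)"
  proof (rule sum_norm_le)
    fix d
    have "norm (of_int (moebius_mu d) :: complex) \<le> 1"
      using abs_moebius_mu_le[of d] by (metis norm_of_int of_int_1_le_iff of_int_le_1_iff of_int_abs)
    then show "norm (of_int (moebius_mu d) * c (d * k)) \<le> 1"
      using c[of "d * k"] by (simp add: norm_mult mult_le_one)
  qed
  also have "\<dots> = real (card {d. d dvd l})" by simp
  also have "\<dots> \<le> real l"
  proof -
    have "card {d. d dvd l} \<le> card {1..l}"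
      using assms(1) by (intro card_mono) (auto dest: dvd_imp_le intro!: Suc_leI Nat.gr0I)
    then show ?thesis by simp
  qed
  also have "\<dots> \<le> real l * real k"
    using assms(2) by (simp add: mult_le_cancel_left1)
  finally show ?thesis
    using assms(1,2) by (simp add: moebius_log_coeff_def norm_divide norm_mult divide_le_eq)
qed

lemma bij_betw_pairs_divisors:
  "bij_betw (\<lambda>(n, l). (l, n div l)) (SIGMA n:{1..}. {l. l dvd n}) ({1::nat..} \<times> {1..})"
proof (rule bij_betwI[where g = "\<lambda>(l, k). (l * k, l)"])
  show "(\<lambda>(n, l). (l, n div l)) \<in> (SIGMA n:{1..}. {l. l dvd n}) \<rightarrow> {1::nat..} \<times> {1..}"
    by (auto elim!: dvdE)
qed (auto simp: dvd_mult_div_cancel elim!: dvdE)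

text \<open>
  Absolute convergence allows grouping the pairs by \<open>n = k * l\<close>. Each group is a finite double divisor
  sum with value \<open>c 1 * w ^ n / n\<close>, and summing over \<open>n\<close> gives the logarithmic series.
\<close>

lemma has_sum_moebius_log:
  fixes w :: complex
  assumes w: "norm w \<le> 1 / 2" and c: "\<And>n. norm (c n) \<le> 1"
    and summable: "(\<lambda>(l, k). moebius_log_coeff c l k * w ^ (k * l)) summable_on {1..} \<times> {1..}"
  shows "((\<lambda>(l, k). moebius_log_coeff c l k * w ^ (k * l)) has_sum (- (c 1 * Ln (1 - w)))) ({1..} \<times> {1..})"
proof -
  define f where "f = (\<lambda>(l, k). moebius_log_coeff c l k * w ^ (k * l))"
  define S where "S = infsum f ({1..} \<times> {1..})"
  have "(f has_sum S) ({1..} \<times> {1..})"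
    unfolding S_def using summable by (intro has_sum_infsum) (simp add: f_def)
  then have "((\<lambda>(n, l). f (l, n div l)) has_sum S) (SIGMA n:{1..}. {l. l dvd n})"
    using has_sum_reindex_bij_betw[OF bij_betw_pairs_divisors, of f S]
    by (simp add: case_prod_unfold)
  moreover have "((\<lambda>l. (case (n, l) of (n, l) \<Rightarrow> f (l, n div l))) has_sum (c 1 * (w ^ n / of_nat n))) {l. l dvd n}"
    if "n \<in> {1..}" for n
  proof (rule has_sum_finiteI)
    show "finite {l. l dvd n}" using that by simp
    have "(\<Sum>l | l dvd n. f (l, n div l))
        = (\<Sum>l | l dvd n. (\<Sum>d | d dvd l. of_int (moebius_mu d) * c (d * (n div l))) * (w ^ n / of_nat n))"
    proof (rule sum.cong)
      fix l assume "l \<in> {l. l dvd n}"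
      then obtain k where "n = l * k" by auto
      then show "f (l, n div l) = (\<Sum>d | d dvd l. of_int (moebius_mu d) * c (d * (n div l))) * (w ^ n / of_nat n)"
        using that by (auto simp: f_def moebius_log_coeff_def mult.commute)
    qed simp
    also have "\<dots> = c 1 * (w ^ n / of_nat n)"
      unfolding sum_distrib_right[symmetric] using that by (subst moebius_mu_double_divisor_sum) auto
    finally show "c 1 * (w ^ n / of_nat n) = (\<Sum>l | l dvd n. (case (n, l) of (n, l) \<Rightarrow> f (l, n div l)))"
      by simp
  qed
  ultimately have "((\<lambda>n. c 1 * (w ^ n / of_nat n)) has_sum S) {1..}"
    by (rule has_sum_SigmaD)
  moreover have "((\<lambda>n. c 1 * (w ^ n / of_nat n)) has_sum (c 1 * (- Ln (1 - w)))) {1..}"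
    using w by (intro has_sum_cmult_right has_sum_log_euler_factor) simp
  ultimately have "S = c 1 * (- Ln (1 - w))"
    by (rule has_sum_unique)
  then show ?thesis
    using \<open>(f has_sum S) ({1..} \<times> {1..})\<close> by (simp add: f_def)
qed

section \<open>Absolute convergence over the primes\<close>

text \<open>
  This uses \<open>k * l \<ge> 1 + (k - 1) + (l - 1)\<close>. One factor \<open>x\<close> is kept for the sum over the primes; the
  others are replaced by \<open>1 / 2\<close> to obtain a bound in which \<open>x\<close>, \<open>k\<close> and \<open>l\<close> are separated.
\<close>

lemma power_mult_le_geometric:
  fixes x :: real
  assumes x: "0 \<le> x" "x \<le> 1 / 2" and "k \<ge> 1" "l \<ge> 1"
  shows "x ^ (k * l) \<le> x * ((1 / 2) ^ (l - 1) * (1 / 2) ^ (k - 1))"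
proof -
  obtain i j where ij: "k = Suc i" "l = Suc j"
    using assms(3,4) by (metis Suc_le_D One_nat_def)
  have "x ^ (k * l) \<le> x ^ (1 + j + i)"
    using x by (intro power_decreasing) (auto simp: ij)
  also have "\<dots> = x * (x ^ j * x ^ i)"
    by (simp add: power_add)
  also have "\<dots> \<le> x * ((1 / 2) ^ j * (1 / 2) ^ i)"
    using x by (intro mult_left_mono mult_mono power_mono) auto
  finally show ?thesis by (simp add: ij)
qed

lemma has_sum_finite_sum:
  fixes f :: "'i \<Rightarrow> 'a \<Rightarrow> 'b :: topological_comm_monoid_add"
  assumes "finite I" "\<And>i. i \<in> I \<Longrightarrow> (f i has_sum S i) A"
  shows "((\<lambda>x. \<Sum>i\<in>I. f i x) has_sum (\<Sum>i\<in>I. S i)) A"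
  using assms by (induction I rule: finite_induct) (auto intro: has_sum_add)

lemma summable_on_times_nonneg:
  fixes f :: "'a \<Rightarrow> real" and g :: "'b \<Rightarrow> real"
  assumes "f summable_on A" "g summable_on B"
    and "\<And>x. x \<in> A \<Longrightarrow> f x \<ge> 0" "\<And>y. y \<in> B \<Longrightarrow> g y \<ge> 0"
  shows "(\<lambda>(x, y). f x * g y) summable_on A \<times> B"
proof (rule summable_on_SigmaI)
  show "((\<lambda>y. case (x, y) of (x, y) \<Rightarrow> f x * g y) has_sum (f x * infsum g B)) B" for x
    using assms(2) by (auto intro: has_sum_cmult_right)
  show "(\<lambda>x. f x * infsum g B) summable_on A"
    using assms(1) by (rule summable_on_cmult_left)
qed (use assms in auto)

lemma summable_on_half_power: "(\<lambda>k. (1 / 2 :: real) ^ (k - 1)) summable_on {1::nat..}"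
proof -
  have "(\<lambda>k. (1 / 2 :: real) ^ k) summable_on UNIV"
    by (rule norm_summable_imp_summable_on) (simp add: summable_geometric)
  moreover have "bij_betw (\<lambda>k. k - 1) {1::nat..} UNIV"
    by (rule bij_betwI[of _ _ _ Suc]) auto
  ultimately show ?thesis
    using summable_on_reindex_bij_betw by blast
qed

lemma
  fixes s :: complex
  assumes s: "Re s > 1"
  shows summable_on_norm_prime_powr: "(\<lambda>p. norm (1 / of_nat p powr s)) summable_on {p. prime p \<and> p \<ge> P}"
    and norm_prime_powr_le_half: "prime p \<Longrightarrow> norm (1 / of_nat p powr s) \<le> 1 / 2"
proof -
  have le: "norm (1 / of_nat p powr s) \<le> 1 / real p powr Re s" if "prime p" for p
    using norm_prime_powr_bound(1)[of 1 s p] s prime_ge_2_nat[OF that] by simp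
  show "norm (1 / of_nat p powr s) \<le> 1 / 2" if "prime p"
  proof -
    have "1 / real p powr Re s < 1 / 2"
      by (rule norm_prime_powr_bound(2)[of 1]) (use s prime_ge_2_nat[OF that] in auto)
    with le[OF that] show ?thesis by linarith
  qed
  have "(\<lambda>p. 1 / real p powr Re s) summable_on UNIV"
    using s by (intro norm_summable_imp_summable_on)
      (simp add: summable_real_powr_iff powr_minus_divide[symmetric])
  then have "(\<lambda>p. 1 / real p powr Re s) summable_on {p. prime p \<and> p \<ge> P}"
    by (rule summable_on_subset_banach) simp
  then show "(\<lambda>p. norm (1 / of_nat p powr s)) summable_on {p. prime p \<and> p \<ge> P}"
    by (rule Infinite_Sum.abs_summable_on_comparison_test') (simp add: le)
qed

text \<open>
  The geometric bound turns the dominating series into a product of three convergent series: one over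
  the primes, which converges because \<open>Re s > 1\<close>, and two geometric ones.
\<close>

lemma summable_on_prime_power_double_series:
  fixes s :: complex
  assumes s: "Re s > 1"
    and coeff: "\<And>p l k. prime p \<Longrightarrow> l \<ge> 1 \<Longrightarrow> k \<ge> 1 \<Longrightarrow> norm (C p l k) \<le> 1"
  shows "(\<lambda>(p, l, k). C p l k * (1 / of_nat p powr s) ^ (k * l) :: complex)
           summable_on ({p. prime p \<and> p \<ge> P} \<times> {1::nat..} \<times> {1::nat..})"
proof -
  let ?f = "\<lambda>(p, l, k). C p l k * (1 / of_nat p powr s) ^ (k * l)"
  let ?g = "\<lambda>(p, y). norm (1 / of_nat p powr s :: complex) * (case y of (l, k) \<Rightarrow> (1 / 2) ^ (l - 1) * (1 / 2) ^ (k - 1))"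
  have g: "?g summable_on ({p. prime p \<and> p \<ge> P} \<times> {1::nat..} \<times> {1::nat..})"
    by (intro summable_on_times_nonneg summable_on_half_power summable_on_norm_prime_powr[OF s]) auto
  have le: "norm (?f x) \<le> ?g x" if "x \<in> {p. prime p \<and> p \<ge> P} \<times> {1..} \<times> {1..}" for x
  proof -
    from that obtain p l k where x: "x = (p, l, k)" "prime p" "l \<ge> 1" "k \<ge> 1"
      by auto
    have "norm (C p l k * (1 / of_nat p powr s) ^ (k * l)) \<le> 1 * norm (1 / of_nat p powr s :: complex) ^ (k * l)"
      unfolding norm_mult norm_power using x by (intro mult_right_mono coeff) auto
    also have "\<dots> \<le> ?g x"
      using power_mult_le_geometric[OF norm_ge_zero norm_prime_powr_le_half[OF s x(2)] x(4,3)]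
      by (simp add: x(1))
    finally show ?thesis
      by (simp add: x(1))
  qed
  show ?thesis
    by (rule abs_summable_summable, rule Infinite_Sum.abs_summable_on_comparison_test'[OF g]) (rule le)
qed

lemma bij_betw_rotate_triple: "bij_betw (\<lambda>(l, p, k). (p, l, k)) (B \<times> A \<times> C) (A \<times> B \<times> C)"
  by (rule bij_betwI[where g = "\<lambda>(p, l, k). (l, p, k)"]) auto

text \<open>
  Here \<open>log_L_from\<close> becomes a single sum over pairs, which is what the exchange of
  summations needs. The condition \<open>d \<ge> 1\<close> matters at primes dividing \<open>q\<close>: there every power of \<open>\<psi>\<close> in the
  character group vanishes, while \<open>\<psi> (p ^ 0) = 1\<close>.
\<close>

lemma has_sum_log_L_from_power:
  assumes q: "q \<ge> 1" and \<psi>: "\<psi> \<in> carrier (dirichlet_group q)" and s: "Re s > 1" and ld: "l \<ge> 1" "d \<ge> 1"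
  shows "((\<lambda>(p, k). \<psi> (int p ^ (d * k)) * (1 / of_nat p powr s) ^ (k * l) / of_nat k)
           has_sum log_L_from P (of_nat l * s) (\<psi> [^]\<^bsub>dirichlet_group q\<^esub> d))
           ({p. prime p \<and> p \<ge> P} \<times> {1..})"
proof -
  define A where "A = {p :: nat. prime p \<and> p \<ge> P}"
  define f where "f = (\<lambda>p k. \<psi> (int p ^ (d * k)) * (1 / of_nat p powr s) ^ (k * l) / of_nat k)"
  have char: "dirichlet_character q \<psi>"
    using \<psi> by (simp add: dirichlet_group_def)
  let ?C = "\<lambda>p l k. \<psi> (int p ^ (d * k)) / of_nat k"
  have C: "norm (?C p l k) \<le> 1" if "k \<ge> 1" for p k
    using that norm_dirichlet_character[OF char q, of "int p ^ (d * k)"]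
    by (simp add: norm_divide divide_le_eq)
  \<comment> \<open>The series at a fixed \<open>l\<close> is a slice of the absolutely convergent triple series.\<close>
  have "(\<lambda>(p, l, k). ?C p l k * (1 / of_nat p powr s) ^ (k * l)) summable_on A \<times> {1..} \<times> {1..}"
    unfolding A_def using C by (intro summable_on_prime_power_double_series[OF s]) simp
  then have "(\<lambda>(l, p, k). ?C p l k * (1 / of_nat p powr s) ^ (k * l)) summable_on {1..} \<times> A \<times> {1..}"
    using summable_on_reindex_bij_betw[OF bij_betw_rotate_triple[of "{1..}" A "{1..}"],
        of "\<lambda>(p, l, k). ?C p l k * (1 / of_nat p powr s) ^ (k * l)"]
    by (simp add: case_prod_unfold)
  then have "(\<lambda>(p, k). ?C p l k * (1 / of_nat p powr s) ^ (k * l)) summable_on A \<times> {1..}"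
    by (rule summable_on_SigmaD1) (use ld in simp)
  then have summable: "(\<lambda>(p, k). f p k) summable_on A \<times> {1..}"
    by (simp add: f_def)
  have "log_L_from P (of_nat l * s) (\<psi> [^]\<^bsub>dirichlet_group q\<^esub> d) = (\<Sum>\<^sub>\<infinity>p\<in>A. \<Sum>\<^sub>\<infinity>k\<in>{1..}. f p k)"
    unfolding log_L_from_def A_def[symmetric]
  proof (intro infsum_cong)
    fix p k :: nat assume "p \<in> A" "k \<in> {1..}"
    then have "p \<noteq> 0" by (auto simp: A_def prime_gt_0_nat)
    have "(\<psi> [^]\<^bsub>dirichlet_group q\<^esub> d) (int p) = \<psi> (int p) ^ d"
      using ld dirichlet_character_0_iff[OF char, of "int p"] by (auto simp: dirichlet_group_pow)
    then have "(\<psi> [^]\<^bsub>dirichlet_group q\<^esub> d) (int p) ^ k = \<psi> (int p ^ (d * k))"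
      by (simp add: dirichlet_character_power[OF char] power_mult)
    moreover have "of_nat p powr (of_nat k * (of_nat l * s)) = (of_nat p powr s :: complex) ^ (k * l)"
      using \<open>p \<noteq> 0\<close> by (simp add: powr_def exp_of_nat_mult[symmetric] mult_ac)
    ultimately show "(\<psi> [^]\<^bsub>dirichlet_group q\<^esub> d) (int p) ^ k / (of_nat k * of_nat p powr (of_nat k * (of_nat l * s))) = f p k"
      by (simp add: f_def power_divide)
  qed
  also have "\<dots> = infsum (\<lambda>(p, k). f p k) (A \<times> {1..})"
    using summable by (rule infsum_Sigma'_banach)
  finally show ?thesis
    using has_sum_infsum[OF summable] by (simp add: f_def A_def)
qed

theorem theorem2:
  fixes q P :: nat and a :: int and s :: complex
  assumes "q \<ge> 1" and "coprime a (int q)" and "P \<ge> 2" and "Re s > 1"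
  shows "(\<lambda>p. ln (1 - 1 / of_nat p powr s) :: complex)
           summable_on {p :: nat. prime p \<and> [int p = a] (mod int q) \<and> p \<ge> P} \<and>
         ((\<lambda>l. 1 / (of_nat l * of_nat (totient q)) *
             (\<Sum>d | d dvd l. of_int (moebius_mu d) *
                (\<Sum>\<psi>\<in>carrier (dirichlet_group q).
                   cnj (\<psi> a) * log_L_from P (of_nat l * s) (\<psi> [^]\<^bsub>dirichlet_group q\<^esub> d))))
           has_sum
             (- (\<Sum>\<^sub>\<infinity>p | prime p \<and> [int p = a] (mod int q) \<and> p \<ge> P. ln (1 - 1 / of_nat p powr s))))
           {1..}"
proof -
  define A where "A = {p :: nat. prime p \<and> p \<ge> P}"
  define w :: "nat \<Rightarrow> complex" where "w = (\<lambda>p. 1 / of_nat p powr s)"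
  define c :: "nat \<Rightarrow> nat \<Rightarrow> complex" where "c = (\<lambda>p n. if [int p ^ n = a] (mod int q) then 1 else 0)"
  define T where "T = (\<lambda>(p, l, k). moebius_log_coeff (c p) l k * w p ^ (k * l))"
  define S where "S = infsum T (A \<times> {1..} \<times> {1..})"
  have c_le: "norm (c p n) \<le> 1" for p n
    by (simp add: c_def)
  have T_summable: "T summable_on A \<times> {1..} \<times> {1..}"
    unfolding T_def A_def w_def using norm_moebius_log_coeff_le[OF _ _ c_le]
    by (intro summable_on_prime_power_double_series[OF \<open>Re s > 1\<close>]) auto
  then have T_sum: "(T has_sum S) (A \<times> {1..} \<times> {1..})"
    by (simp add: S_def)

  \<comment> \<open>Summation with \<open>p\<close> outermost gives the left-hand side.\<close>
  have "((\<lambda>p. - (c p 1 * Ln (1 - w p))) has_sum S) A"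
  proof (rule has_sum_SigmaD[OF T_sum])
    fix p assume p: "p \<in> A"
    have "(\<lambda>(l, k). moebius_log_coeff (c p) l k * w p ^ (k * l)) summable_on {1..} \<times> {1..}"
    proof (rule summable_on_SigmaD1[OF _ p])
      show "(\<lambda>(p, y). (\<lambda>(l, k). moebius_log_coeff (c p) l k * w p ^ (k * l)) y) summable_on A \<times> {1..} \<times> {1..}"
        using T_summable by (simp add: T_def)
    qed
    then have "((\<lambda>(l, k). moebius_log_coeff (c p) l k * w p ^ (k * l)) has_sum (- (c p 1 * Ln (1 - w p)))) ({1..} \<times> {1..})"
      using norm_prime_powr_le_half[OF \<open>Re s > 1\<close>] p c_le
      by (intro has_sum_moebius_log) (auto simp: w_def A_def)
    then show "((\<lambda>y. T (p, y)) has_sum (- (c p 1 * Ln (1 - w p)))) ({1..} \<times> {1..})"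
      by (simp add: T_def)
  qed
  then have "((\<lambda>p. - Ln (1 - w p)) has_sum S) {p. prime p \<and> [int p = a] (mod int q) \<and> p \<ge> P}"
    by (rule has_sum_cong_neutral[THEN iffD1, rotated -1]) (auto simp: A_def c_def)
  then have ln_sum: "((\<lambda>p. Ln (1 - w p)) has_sum (- S)) {p. prime p \<and> [int p = a] (mod int q) \<and> p \<ge> P}"
    using has_sum_uminusI by fastforce

  \<comment> \<open>Summation with \<open>l\<close> outermost gives the right-hand side, via orthogonality.\<close>
  let ?F = "\<lambda>l. 1 / (of_nat l * of_nat (totient q)) *
             (\<Sum>d | d dvd l. of_int (moebius_mu d) *
                (\<Sum>\<psi>\<in>carrier (dirichlet_group q).
                   cnj (\<psi> a) * log_L_from P (of_nat l * s) (\<psi> [^]\<^bsub>dirichlet_group q\<^esub> d)))"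
  have "((\<lambda>(l, p, k). T (p, l, k)) has_sum S) ({1..} \<times> A \<times> {1..})"
    using has_sum_reindex_bij_betw[OF bij_betw_rotate_triple[of "{1..}" A "{1..}"], of T S] T_sum
    by (simp add: case_prod_unfold)
  then have "(?F has_sum S) {1..}"
  proof (rule has_sum_SigmaD)
    fix l :: nat assume "l \<in> {1..}"
    then have l: "l \<ge> 1" by simp
    let ?t = "\<lambda>\<psi> d p k. \<psi> (int p ^ (d * k)) * w p ^ (k * l) / of_nat k :: complex"
    have "((\<lambda>x. 1 / (of_nat l * of_nat (totient q)) *
             (\<Sum>d | d dvd l. of_int (moebius_mu d) *
                (\<Sum>\<psi>\<in>carrier (dirichlet_group q). cnj (\<psi> a) * (case x of (p, k) \<Rightarrow> ?t \<psi> d p k)))) has_sum ?F l)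
          (A \<times> {1..})"
      unfolding A_def w_def using l \<open>q \<ge> 1\<close> \<open>Re s > 1\<close>
      by (intro has_sum_cmult_right has_sum_finite_sum has_sum_log_L_from_power finite_dirichlet_group)
        (auto intro: dvd_pos_nat Suc_leI)
    moreover have "1 / (of_nat l * of_nat (totient q)) *
             (\<Sum>d | d dvd l. of_int (moebius_mu d) *
                (\<Sum>\<psi>\<in>carrier (dirichlet_group q). cnj (\<psi> a) * ?t \<psi> d p k)) = T (p, l, k)" for p k
    proof -
      have tot: "of_nat (totient q) \<noteq> (0 :: complex)"
        using \<open>q \<ge> 1\<close> by simp
      have inner: "(\<Sum>\<psi>\<in>carrier (dirichlet_group q). cnj (\<psi> a) * ?t \<psi> d p k)
          = of_nat (totient q) * c p (d * k) * (w p ^ (k * l) / of_nat k)" for d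
      proof -
        have "(\<Sum>\<psi>\<in>carrier (dirichlet_group q). cnj (\<psi> a) * ?t \<psi> d p k)
            = (\<Sum>\<psi>\<in>carrier (dirichlet_group q). cnj (\<psi> a) * \<psi> (int p ^ (d * k))) * (w p ^ (k * l) / of_nat k)"
          unfolding sum_distrib_right by (intro sum.cong) simp_all
        then show ?thesis
          unfolding dirichlet_character_orthogonality[OF \<open>q \<ge> 1\<close> \<open>coprime a (int q)\<close>] by (simp add: c_def)
      qed
      have "(\<Sum>d | d dvd l. of_int (moebius_mu d) *
                (\<Sum>\<psi>\<in>carrier (dirichlet_group q). cnj (\<psi> a) * ?t \<psi> d p k))
          = (\<Sum>d | d dvd l. of_int (moebius_mu d) * c p (d * k)) * (of_nat (totient q) * (w p ^ (k * l) / of_nat k))"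
        unfolding inner sum_distrib_right by (intro sum.cong refl) (simp only: mult_ac)
      then show ?thesis
        using tot by (simp add: T_def moebius_log_coeff_def)
    qed
    ultimately show "((\<lambda>y. case (l, y) of (l, p, k) \<Rightarrow> T (p, l, k)) has_sum ?F l) (A \<times> {1..})"
      by (simp add: case_prod_unfold)
  qed
  then show ?thesis
    using ln_sum by (auto simp: w_def summable_on_def dest: infsumI)
qed

end
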